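(* Let $p$ be a prime. If there exists a counterexample to the $p$-adic Littlewood conjecture, then there exists a counterexample $x\in[0,1]$ to the $p$-adic Littlewood conjecture whose base-$p$ expansion is uniformly recurrent.
   Context: A real number $x$ satisfies the $p$-adic Littlewood conjecture (pLC) if $\liminf_{q\to\infty} q\cdot|q|_p\cdot\|qx\|=0$, where $q$ runs over the positive integers, $|\cdot|_p$ is the $p$-adic absolute value and $\|\cdot\|$ is the distance to the nearest integer. A counterexample to pLC is a real number that does not satisfy pLC (rational numbers always satisfy pLC, so counterexamples are irrational). For irrational $x\in[0,1]$, the base-$p$ expansion of $x$ is the unique infinite word $a_1a_2a_3\cdots$ on $\{0,1,\dots,p-1\}$ with $x=\sum_{i\ge1}a_ip^{-i}$. An infinite word $w$ is uniformly recurrent if for every finite subword (block of consecutive letters) $v$ of $w$ there exists a constant $N_v$ such that $v$ appears in every subword of $w$ of length $N_v$. *)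

theory Defs
  imports
    "HOL-Analysis.Analysis"
    "HOL-Computational_Algebra.Primes"
    "HOL-Library.Omega_Words_Fun"
    "HOL-Library.Sublist"
begin

definition padic_abs :: "nat \<Rightarrow> nat \<Rightarrow> real" where
  "padic_abs p q = (if q = 0 then 0 else 1 / real p ^ multiplicity p q)"

definition dist_nearest_int :: "real \<Rightarrow> real" where
  "dist_nearest_int x = \<bar>x - of_int (round x)\<bar>"

(* liminf is taken in ereal, as it needs a complete lattice; it does not depend on the term q = 0. *)
definition pLC :: "nat \<Rightarrow> real \<Rightarrow> bool" where
  "pLC p x \<longleftrightarrow>
     liminf (\<lambda>q::nat. ereal (real q * padic_abs p q * dist_nearest_int (real q * x))) = 0"

definition pLC_counterexample :: "nat \<Rightarrow> real \<Rightarrow> bool" where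
  "pLC_counterexample p x \<longleftrightarrow> \<not> pLC p x"

(* Words are indexed from 0, so the letter w i is the digit with weight p^-(i+1).
   For prime p, every real in the unit interval has such a word, and it is unique if the real is
   irrational (as counterexamples to pLC are). *)
definition is_base_expansion :: "nat \<Rightarrow> real \<Rightarrow> nat word \<Rightarrow> bool" where
  "is_base_expansion p x w \<longleftrightarrow>
     (\<forall>i. w i < p) \<and> (\<lambda>i. real (w i) / real p ^ Suc i) sums x"

(* subsequence w i j is the block of the letters w i, ..., w (j - 1), and sublist (from
   HOL-Library.Sublist) requires the letters to be consecutive. *)
definition uniformly_recurrent :: "'a word \<Rightarrow> bool" where
  "uniformly_recurrent w \<longleftrightarrow>
     (\<forall>i n. \<exists>N. \<forall>j. sublist (subsequence w i (i + n)) (subsequence w j (j + N)))"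

end

theory Submission
  imports Defs
begin

text \<open>For fixed \<open>e > 0\<close>, the reals \<open>x\<close> with \<open>q |q|\<^sub>p \<parallel>q x\<parallel> \<ge> e\<close> for all \<open>q \<ge> 1\<close> form a closed set. It is
  invariant under \<open>x \<mapsto> p x - a\<close> for integers \<open>a\<close>, because \<open>q |q|\<^sub>p\<close> does not change when \<open>q\<close> is
  multiplied by \<open>p\<close>. The base-\<open>p\<close> expansions of its elements therefore form a subshift, and all
  words of a minimal subshift of it are uniformly recurrent.\<close>

section \<open>Minimal subshifts\<close>

text \<open>Zorn's lemma, where compactness of \<open>K\<close> keeps the intersection of a chain of
  nonempty closed invariant subsets nonempty.\<close>

lemma minimal_invariant_closed_subset:
  fixes T :: "'a::topological_space \<Rightarrow> 'a"
  assumes "compact K" "closed K" "K \<noteq> {}" "T ` K \<subseteq> K"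
  obtains M where "closed M" "M \<subseteq> K" "M \<noteq> {}" "T ` M \<subseteq> M"
    "\<And>N. closed N \<Longrightarrow> N \<subseteq> M \<Longrightarrow> N \<noteq> {} \<Longrightarrow> T ` N \<subseteq> N \<Longrightarrow> N = M"
proof -
  \<comment> \<open>The members are complements of the candidate sets, so that a chain is bounded by
    its union and open covers of \<open>K\<close> can be used directly. Given
    \<open>-K \<subseteq> U\<close>, the condition \<open>\<not> K \<subseteq> U\<close> says that
    the candidate \<open>-U\<close> is nonempty.\<close>
  define \<A> where "\<A> = {U. open U \<and> -K \<subseteq> U \<and> \<not> K \<subseteq> U \<and> T ` (-U) \<subseteq> -U}"
  have "-K \<in> \<A>"
    using assms by (auto simp: \<A>_def)
  have "\<exists>U\<in>\<A>. \<forall>V\<in>\<A>. U \<subseteq> V \<longrightarrow> V = U"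
  proof (rule subset_Zorn_nonempty)
    show "\<A> \<noteq> {}"
      using \<open>-K \<in> \<A>\<close> by blast
  next
    fix \<C> assume \<C>: "\<C> \<noteq> {}" "subset.chain \<A> \<C>"
    hence sub: "\<C> \<subseteq> \<A>"
      by (simp add: subset.chain_def)
    have "\<not> K \<subseteq> \<Union>\<C>"
    proof
      assume "K \<subseteq> \<Union>\<C>"
      moreover have "open U" if "U \<in> \<C>" for U
        using sub that by (auto simp: \<A>_def)
      ultimately obtain \<D> where \<D>: "\<D> \<subseteq> \<C>" "finite \<D>" "K \<subseteq> \<Union>\<D>"
        by (rule compactE[OF \<open>compact K\<close>])
      have "\<D> \<noteq> {}"
        using \<D> \<open>K \<noteq> {}\<close> by auto
      moreover have "subset.chain \<A> \<D>"
        using \<C>(2) \<D>(1) unfolding subset.chain_def by blast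
      \<comment> \<open>A nonempty finite chain contains its union, so a single member would already
        cover \<open>K\<close>.\<close>
      ultimately have "\<Union>\<D> \<in> \<D>"
        using \<D>(2) by (intro Union_in_chain)
      thus False
        using \<D> sub by (auto simp: \<A>_def)
    qed
    moreover have "open (\<Union>\<C>)" "-K \<subseteq> \<Union>\<C>"
      using sub \<C>(1) by (auto simp: \<A>_def)
    moreover have "T ` (-\<Union>\<C>) \<subseteq> -\<Union>\<C>"
      using sub unfolding \<A>_def by blast
    ultimately show "\<Union>\<C> \<in> \<A>"
      by (simp add: \<A>_def)
  qed
  then obtain U where U: "U \<in> \<A>" and max: "\<And>V. V \<in> \<A> \<Longrightarrow> U \<subseteq> V \<Longrightarrow> V = U"
    by blast
  show thesis
  proof (rule that[of "-U"])
    show "closed (-U)" "-U \<subseteq> K" "-U \<noteq> {}" "T ` (-U) \<subseteq> -U"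
      using U by (auto simp: \<A>_def)
    fix N assume N: "closed N" "N \<subseteq> -U" "N \<noteq> {}" "T ` N \<subseteq> N"
    have "-U \<subseteq> K"
      using U by (auto simp: \<A>_def)
    hence "-N \<in> \<A>"
      using N by (auto simp: \<A>_def)
    thus "N = -U"
      using max[of "-N"] N(2) by blast
  qed
qed

lemma sublist_subsequenceI:
  assumes "\<And>k. k < n \<Longrightarrow> v (l + k) = w (i + k)" "j \<le> l" "l + n \<le> m"
  shows "sublist (subsequence w i (i + n)) (subsequence v j m)"
proof -
  have "[j..<m] = [j..<l] @ [l..<l + n] @ [l + n..<m]"
    using assms(2,3) upt_add_eq_append[of j l "m - l"] upt_add_eq_append[of l "l + n" "m - (l + n)"]
    by simp
  moreover have "map v [l..<l + n] = map w [i..<i + n]"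
    using assms(1) by (intro nth_equalityI) auto
  ultimately show ?thesis
    unfolding subsequence_def sublist_def by (metis map_append)
qed

text \<open>The words of \<open>M\<close> that avoid a given block of \<open>w\<close> form a closed
  shift-invariant set. It is not all of \<open>M\<close>, as \<open>w\<close> is missing, so by
  minimality it is empty. Hence the block occurs in every word of \<open>M\<close>, and compactness
  bounds where.\<close>

lemma minimal_subshift_uniformly_recurrent:
  fixes M :: "'a::discrete_topology word set"
  assumes "compact M" "closed M" and inv: "\<And>w. w \<in> M \<Longrightarrow> (\<lambda>i. w (Suc i)) \<in> M"
    and minimal: "\<And>N. closed N \<Longrightarrow> N \<subseteq> M \<Longrightarrow> N \<noteq> {} \<Longrightarrow> (\<And>w. w \<in> N \<Longrightarrow> (\<lambda>i. w (Suc i)) \<in> N) \<Longrightarrow> N = M"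
    and "w \<in> M"
  shows "uniformly_recurrent w"
  unfolding uniformly_recurrent_def
proof (intro allI)
  fix i n
  \<comment> \<open>The words in which the block occurs at position \<open>j\<close>. Only finitely
    many discrete coordinates are restricted, so this set is open.\<close>
  define U where "U j = {v :: 'a word. \<forall>k<n. v (j + k) = w (i + k)}" for j
  have shift: "(\<lambda>k. v (j + k)) \<in> M" if "v \<in> M" for v j
    using that by (induction j) (auto dest: inv)
  have open_U: "open (U j)" for j
  proof -
    have "open {v :: 'a word. v (j + k) = a}" for k a
    proof -
      have "open ((\<lambda>v :: 'a word. v (j + k)) -` {a})"
        by (intro open_vimage open_discrete continuous_on_product_coordinates)
      moreover have "(\<lambda>v :: 'a word. v (j + k)) -` {a} = {v. v (j + k) = a}"
        by auto
      ultimately show ?thesis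
        by simp
    qed
    hence "open (\<Inter>k\<in>{..<n}. {v :: 'a word. v (j + k) = w (i + k)})"
      by (intro open_INT) auto
    moreover have "(\<Inter>k\<in>{..<n}. {v :: 'a word. v (j + k) = w (i + k)}) = U j"
      by (auto simp: U_def)
    ultimately show ?thesis
      by simp
  qed
  have "M - (\<Union>j. U j) = {}"
  proof (rule ccontr)
    assume nonempty: "M - (\<Union>j. U j) \<noteq> {}"
    have "M - (\<Union>j. U j) = M"
    proof (rule minimal)
      show "closed (M - (\<Union>j. U j))"
        using \<open>closed M\<close> open_U by (intro closed_Diff) auto
      show "(\<lambda>i. v (Suc i)) \<in> M - (\<Union>j. U j)" if v: "v \<in> M - (\<Union>j. U j)" for v
      proof -
        \<comment> \<open>An occurrence in the shifted word lies one position later in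
          \<open>v\<close>.\<close>
        have "(\<lambda>i. v (Suc i)) \<in> U j \<Longrightarrow> v \<in> U (Suc j)" for j
          by (simp add: U_def)
        thus ?thesis
          using v inv by blast
      qed
    qed (use nonempty in auto)
    moreover have "w \<in> U i"
      by (simp add: U_def)
    ultimately show False
      using \<open>w \<in> M\<close> by blast
  qed
  hence cover: "M \<subseteq> (\<Union>j\<in>UNIV. U j)"
    by blast
  obtain J where J: "finite J" "M \<subseteq> (\<Union>j\<in>J. U j)"
    by (rule compactE_image[OF \<open>compact M\<close> open_U cover])
  define N where "N = Max J"
  have N: "j \<le> N" if "j \<in> J" for j
    using J(1) that by (simp add: N_def)
  \<comment> \<open>The finite cover is applied to the shift of \<open>w\<close> by
    \<open>j\<close>: an occurrence starts at most \<open>N\<close> letters after \<open>j\<close>,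
    so its \<open>n\<close> letters fit into a window of length \<open>N + n\<close>.\<close>
  have "sublist (subsequence w i (i + n)) (subsequence w j (j + (N + n)))" for j
  proof -
    obtain l where l: "l \<in> J" "(\<lambda>k. w (j + k)) \<in> U l"
      using J(2) shift[OF \<open>w \<in> M\<close>, of j] by blast
    show ?thesis
    proof (rule sublist_subsequenceI)
      show "w (j + l + k) = w (i + k)" if "k < n" for k
        using l(2) that by (simp add: U_def add.assoc)
    qed (use N[OF l(1)] in auto)
  qed
  thus "\<exists>N. \<forall>j. sublist (subsequence w i (i + n)) (subsequence w j (j + N))"
    by blast
qed

section \<open>Digit words\<close>

definition digit_words :: "nat \<Rightarrow> nat word set" where
  "digit_words p = {w. \<forall>i. w i < p}"

definition word_value :: "nat \<Rightarrow> nat word \<Rightarrow> real" where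
  "word_value p w = (\<Sum>i. real (w i) / real p ^ Suc i)"

text \<open>Tychonoff's theorem for a product of finite sets; closedness is checked coordinate by
  coordinate.\<close>

lemma closed_digit_words: "closed (digit_words p)"
  and compact_digit_words: "compact (digit_words p)"
proof -
  have eq: "digit_words p = (\<Pi>\<^sub>E i\<in>UNIV. {..<p})"
    by (auto simp: digit_words_def PiE_def)
  have "compactin (product_topology (\<lambda>i::nat. euclidean) UNIV) (\<Pi>\<^sub>E i\<in>UNIV. {..<p})"
    by (simp add: compactin_PiE finite_imp_compact)
  thus "compact (digit_words p)"
    by (simp add: eq euclidean_product_topology)
  have "closed ((\<lambda>w :: nat word. w i) -` {..<p})" for i
    by (intro closed_vimage continuous_on_product_coordinates) (simp add: closed_def open_discrete)
  hence "closed (\<Inter>i. (\<lambda>w :: nat word. w i) -` {..<p})"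
    by (intro closed_INT) auto
  moreover have "(\<Inter>i. (\<lambda>w :: nat word. w i) -` {..<p}) = digit_words p"
    by (auto simp: digit_words_def)
  ultimately show "closed (digit_words p)"
    by simp
qed

text \<open>A geometric series. It dominates every digit series, which yields summability, the upper
  bound 1 on values and uniform convergence.\<close>

lemma sums_max_digits:
  assumes "2 \<le> p"
  shows "(\<lambda>i. (real p - 1) / real p ^ Suc i) sums 1"
proof -
  have "(\<lambda>i. (real p - 1) / real p * (1 / real p) ^ i) sums ((real p - 1) / real p * (1 / (1 - 1 / real p)))"
    using assms by (intro sums_mult geometric_sums) auto
  moreover have "(real p - 1) / real p * (1 / (1 - 1 / real p)) = 1"
    using assms by (simp add: field_simps)
  moreover have "(\<lambda>i. (real p - 1) / real p * (1 / real p) ^ i) = (\<lambda>i. (real p - 1) / real p ^ Suc i)"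
    by (simp add: power_divide)
  ultimately show ?thesis
    by (simp only:)
qed

lemma digit_le:
  assumes "w \<in> digit_words p"
  shows "real (w i) / real p ^ Suc i \<le> (real p - 1) / real p ^ Suc i"
proof -
  have "Suc (w i) \<le> p"
    using assms by (simp add: digit_words_def Suc_le_eq)
  thus ?thesis
    by (intro divide_right_mono) auto
qed

lemma summable_digits:
  assumes "2 \<le> p" "w \<in> digit_words p"
  shows "summable (\<lambda>i. real (w i) / real p ^ Suc i)"
  by (rule summable_comparison_test'[OF sums_summable[OF sums_max_digits[OF assms(1)]]])
    (use digit_le[OF assms(2)] in auto)

lemma word_value_bounds:
  assumes "2 \<le> p" "w \<in> digit_words p"
  shows "0 \<le> word_value p w" "word_value p w \<le> 1"
proof -
  show "0 \<le> word_value p w"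
    unfolding word_value_def by (intro suminf_nonneg summable_digits assms) auto
  show "word_value p w \<le> 1"
    unfolding word_value_def
    using sums_le[OF digit_le[OF assms(2)] summable_sums[OF summable_digits[OF assms]]
        sums_max_digits[OF assms(1)]] .
qed

text \<open>Multiplication by \<open>p\<close> moves every digit up one place and makes the first
  one an integer summand. Thus the shift on words acts on values by the maps that preserve
  \<open>pLC_gap\<close>.\<close>

lemma word_value_shift:
  assumes "2 \<le> p" "w \<in> digit_words p"
  shows "word_value p (\<lambda>i. w (Suc i)) = real p * word_value p w - real (w 0)"
proof -
  have "(\<lambda>i. w (Suc i)) \<in> digit_words p"
    using assms(2) by (simp add: digit_words_def)
  hence "real p * (\<Sum>i. real (w (Suc i)) / real p ^ Suc (Suc i)) = word_value p (\<lambda>i. w (Suc i))"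
    unfolding word_value_def using assms(1) summable_digits[OF assms]
    by (subst suminf_mult[symmetric]) (simp_all only: summable_Suc_iff[of "\<lambda>i. real (w i) / real p ^ Suc i"], simp)
  moreover have "(\<Sum>i. real (w (Suc i)) / real p ^ Suc (Suc i)) = word_value p w - real (w 0) / real p"
    using suminf_split_head[OF summable_digits[OF assms]] by (simp add: word_value_def)
  ultimately show ?thesis
    using assms(1) by (simp add: field_simps)
qed

text \<open>The partial sums depend on finitely many coordinates and converge uniformly by the
  Weierstrass M-test.\<close>

lemma continuous_on_word_value:
  assumes "2 \<le> p"
  shows "continuous_on (digit_words p) (word_value p)"
proof (rule uniform_limit_theorem)
  show "uniform_limit (digit_words p) (\<lambda>n w. \<Sum>i<n. real (w i) / real p ^ Suc i) (word_value p) sequentially"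
    unfolding word_value_def
    by (rule Weierstrass_m_test[OF _ sums_summable[OF sums_max_digits[OF assms]]])
      (use digit_le in auto)
  have "continuous_on (digit_words p) (\<lambda>w. w i)" for i
    by (rule continuous_on_subset[OF continuous_on_product_coordinates]) auto
  thus "\<forall>\<^sub>F n in sequentially. continuous_on (digit_words p) (\<lambda>w. \<Sum>i<n. real (w i) / real p ^ Suc i)"
    using assms by (intro always_eventually allI continuous_intros) auto
qed simp

lemma ex_digit_word:
  assumes "2 \<le> p" "0 \<le> x" "x < 1"
  shows "\<exists>w\<in>digit_words p. word_value p w = x"
proof -
  \<comment> \<open>\<open>a n\<close> is the integer written by the first \<open>n\<close> digits
    of \<open>x\<close>, so \<open>w n\<close> is the last digit of
    \<open>a (Suc n)\<close>.\<close>
  define a where "a n = \<lfloor>real p ^ n * x\<rfloor>" for n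
  define w where "w n = nat (a (Suc n) - int p * a n)" for n
  have a: "real_of_int (a n) \<le> real p ^ n * x" "real p ^ n * x < real_of_int (a n) + 1" for n
    by (auto simp: a_def)
  have pa: "int p * a n \<le> a (Suc n)" "a (Suc n) < int p * a n + int p" for n
  proof -
    have "real p * real_of_int (a n) \<le> real p ^ Suc n * x"
      using a(1)[of n] assms(1) by (simp add: mult.assoc)
    thus "int p * a n \<le> a (Suc n)"
      unfolding a_def[of "Suc n"] by (simp add: le_floor_iff)
    have "real p ^ Suc n * x < real p * (real_of_int (a n) + 1)"
      using a(2)[of n] assms(1) by (simp add: mult.assoc)
    thus "a (Suc n) < int p * a n + int p"
      unfolding a_def[of "Suc n"] by (simp add: floor_less_iff algebra_simps)
  qed
  have w: "real (w n) = real_of_int (a (Suc n)) - real p * real_of_int (a n)" for n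
    using pa(1)[of n] by (simp add: w_def)
  have "w n < p" for n
    using pa[of n] by (simp add: w_def nat_less_iff)
  hence "w \<in> digit_words p"
    by (simp add: digit_words_def)
  have partial: "(\<Sum>i<n. real (w i) / real p ^ Suc i) = real_of_int (a n) / real p ^ n" for n
  proof (induction n)
    case 0
    \<comment> \<open>Here \<open>x < 1\<close> enters: the telescoping sum leaves no integer part
      behind.\<close>
    have "a 0 = 0"
      using assms by (simp add: a_def floor_eq_iff)
    thus ?case
      by simp
  next
    case (Suc n)
    thus ?case
      using assms(1) by (simp add: w field_simps)
  qed
  have "(\<lambda>n. real_of_int (a n) / real p ^ n) \<longlonglongrightarrow> x"
  proof (rule tendsto_sandwich)
    show "\<forall>\<^sub>F n in sequentially. x - (1 / real p) ^ n \<le> real_of_int (a n) / real p ^ n"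
    proof (intro always_eventually allI)
      show "x - (1 / real p) ^ n \<le> real_of_int (a n) / real p ^ n" for n
        using a(2)[of n] assms(1) by (simp add: power_one_over pos_le_divide_eq right_diff_distrib mult.commute)
    qed
    show "\<forall>\<^sub>F n in sequentially. real_of_int (a n) / real p ^ n \<le> x"
      using a(1) assms(1) by (intro always_eventually allI) (auto simp: field_simps)
    have "(\<lambda>n. (1 / real p) ^ n) \<longlonglongrightarrow> 0"
      using assms(1) by (intro LIMSEQ_realpow_zero) auto
    thus "(\<lambda>n. x - (1 / real p) ^ n) \<longlonglongrightarrow> x"
      using tendsto_diff[OF tendsto_const, of "\<lambda>n. (1 / real p) ^ n" 0 sequentially x] by simp
  qed simp
  hence "(\<lambda>i. real (w i) / real p ^ Suc i) sums x"
    by (simp only: sums_def partial)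
  thus ?thesis
    using \<open>w \<in> digit_words p\<close> by (auto simp: word_value_def sums_iff)
qed

section \<open>Quantitative counterexamples\<close>

text \<open>Quantifying over all integers \<open>m\<close> replaces the distance to the nearest integer.\<close>

definition pLC_gap :: "nat \<Rightarrow> real \<Rightarrow> real set" where
  "pLC_gap p e = {x. \<forall>q>0. \<forall>m::int. e \<le> real q * padic_abs p q * \<bar>real q * x - of_int m\<bar>}"

lemma closed_pLC_gap: "closed (pLC_gap p e)"
  unfolding pLC_gap_def
  by (intro closed_Collect_all closed_Collect_imp closed_Collect_le continuous_intros) auto

lemma padic_abs_nonneg: "0 \<le> padic_abs p q"
  by (simp add: padic_abs_def)

lemma padic_abs_mult_le:
  assumes "prime p" "0 < n" "0 < q"
  shows "padic_abs p (n * q) \<le> padic_abs p q"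
proof -
  have "multiplicity p q \<le> multiplicity p (n * q)"
    using assms by (intro dvd_imp_multiplicity_le) auto
  moreover have "1 \<le> real p"
    using prime_ge_1_nat[OF assms(1)] by simp
  ultimately show ?thesis
    using assms by (simp add: padic_abs_def frac_le power_increasing)
qed

text \<open>The bound at \<open>q\<close> and \<open>m\<close> for the new number is the bound at
  \<open>p * q\<close> and \<open>q * a + m\<close> for \<open>x\<close>: the weights agree, and so
  do the differences.\<close>

lemma pLC_gap_affine:
  assumes "prime p" "x \<in> pLC_gap p e"
  shows "real p * x - of_int a \<in> pLC_gap p e"
proof -
  have "e \<le> real q * padic_abs p q * \<bar>real q * (real p * x - of_int a) - of_int m\<bar>" if "0 < q" for q and m :: int
  proof -
    have p: "0 < p"
      using prime_gt_0_nat[OF assms(1)] .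
    have "multiplicity p (p * q) = Suc (multiplicity p q)"
      using assms(1) that p by (intro multiplicity_times_same) auto
    hence "real (p * q) * padic_abs p (p * q) = real q * padic_abs p q"
      using p that by (simp add: padic_abs_def)
    moreover have "e \<le> real (p * q) * padic_abs p (p * q) * \<bar>real (p * q) * x - of_int (int q * a + m)\<bar>"
      using assms(2) p that unfolding pLC_gap_def mem_Collect_eq
      by (elim allE[of _ "p * q"] allE[of _ "int q * a + m"] impE) auto
    moreover have "real (p * q) * x - of_int (int q * a + m) = real q * (real p * x - of_int a) - of_int m"
      by (simp add: algebra_simps)
    ultimately show ?thesis
      by (simp only:)
  qed
  thus ?thesis
    by (simp add: pLC_gap_def)
qed

lemma pLC_gap_imp_counterexample:
  assumes "0 < e" "x \<in> pLC_gap p e"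
  shows "pLC_counterexample p x"
proof -
  \<comment> \<open>The nearest integer serves as \<open>m\<close>; the bound is only available for
    \<open>q > 0\<close>.\<close>
  have "ereal e \<le> liminf (\<lambda>q. ereal (real q * padic_abs p q * dist_nearest_int (real q * x)))"
    using assms(2)
    by (intro Liminf_bounded eventually_mono[OF eventually_gt_at_top[of "0::nat"]])
      (simp add: pLC_gap_def dist_nearest_int_def)
  thus ?thesis
    using assms(1) by (auto simp: pLC_counterexample_def pLC_def)
qed

text \<open>A positive liminf bounds only the terms from some \<open>N\<close> on. A small
  \<open>q\<close> is handled through its multiple \<open>n * q \<ge> N\<close>: this costs one
  factor \<open>n\<close> in the weight and one in the distance, hence the constant
  \<open>e / n^2\<close>, while the \<open>p\<close>-adic absolute value does not increase.\<close>

lemma pLC_counterexample_imp_gap: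
  assumes "prime p" "pLC_counterexample p x"
  obtains e where "0 < e" "x \<in> pLC_gap p e"
proof -
  define t where "t q = real q * padic_abs p q * dist_nearest_int (real q * x)" for q
  \<comment> \<open>All terms are nonnegative, so a liminf different from 0 is positive.\<close>
  have "0 \<le> liminf (\<lambda>q. ereal (t q))"
    by (intro Liminf_bounded always_eventually) (simp add: t_def padic_abs_nonneg dist_nearest_int_def)
  hence "0 < liminf (\<lambda>q. ereal (t q))"
    using assms(2) by (simp add: pLC_counterexample_def pLC_def t_def order_less_le)
  then obtain e where e: "0 < ereal e" "ereal e < liminf (\<lambda>q. ereal (t q))"
    using ereal_dense2 by blast
  from less_LiminfD[OF e(2)] obtain N where N: "\<And>q. q \<ge> N \<Longrightarrow> e < t q"
    by (auto simp: eventually_sequentially)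
  define n where "n = Suc N"
  have "e / (real n)\<^sup>2 \<le> real q * padic_abs p q * \<bar>real q * x - of_int m\<bar>" if "0 < q" for q and m :: int
  proof -
    have "N \<le> n * q"
      using that by (cases q) (auto simp: n_def)
    hence "e \<le> t (n * q)"
      using N by (intro less_imp_le)
    \<comment> \<open>The integer nearest to \<open>n * q * x\<close> is at least as close to it as
      \<open>n * m\<close>.\<close>
    also have "\<dots> \<le> real (n * q) * padic_abs p q * \<bar>real (n * q) * x - of_int (int n * m)\<bar>"
      unfolding t_def dist_nearest_int_def
      by (intro mult_mono mult_left_mono padic_abs_mult_le round_diff_minimal assms(1) that)
        (auto simp: n_def padic_abs_nonneg)
    also have "real (n * q) * x - of_int (int n * m) = real n * (real q * x - of_int m)"
      by (simp add: algebra_simps)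
    also have "real (n * q) * padic_abs p q * \<bar>real n * (real q * x - of_int m)\<bar> =
        real q * padic_abs p q * \<bar>real q * x - of_int m\<bar> * (real n)\<^sup>2"
      by (simp add: abs_mult power2_eq_square)
    finally show ?thesis
      by (subst pos_divide_le_eq) (simp_all add: n_def)
  qed
  hence "x \<in> pLC_gap p (e / (real n)\<^sup>2)"
    by (simp add: pLC_gap_def)
  moreover have "0 < e / (real n)\<^sup>2"
    using e(1) by (simp add: n_def)
  ultimately show thesis
    by (rule that[rotated])
qed

theorem theorem2p6:
  fixes p :: nat
  assumes "prime p"
    and "\<exists>y :: real. pLC_counterexample p y"
  shows "\<exists>x :: real. 0 \<le> x \<and> x \<le> 1 \<and> pLC_counterexample p x \<and>
           (\<exists>w. is_base_expansion p x w \<and> uniformly_recurrent w)"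
proof -
  have p: "2 \<le> p"
    using prime_ge_2_nat[OF assms(1)] .
  obtain y e where "0 < e" and y: "y \<in> pLC_gap p e"
    using assms pLC_counterexample_imp_gap by metis
  define K where "K = digit_words p \<inter> word_value p -` pLC_gap p e"
  define T where "T w = (\<lambda>i. w (Suc i))" for w :: "nat word"
  have closed: "closed K"
    unfolding K_def Int_commute[of "digit_words p"]
    by (intro closed_vimage_Int continuous_on_word_value closed_digit_words closed_pLC_gap p)
  have compact: "compact K"
    using compact_Int_closed[OF compact_digit_words closed, of p] by (simp add: K_def Int_absorb1 flip: Int_assoc)
  \<comment> \<open>The number \<open>y\<close> may lie outside the unit interval. Since the
    invariance concerns translates of \<open>p * y\<close>, the fractional part of
    \<open>p * y\<close>, not that of \<open>y\<close>, supplies a word in \<open>K\<close>.\<close>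
  have "real p * y - of_int \<lfloor>real p * y\<rfloor> \<in> pLC_gap p e"
    using assms(1) y by (rule pLC_gap_affine)
  moreover obtain w where "w \<in> digit_words p" "word_value p w = frac (real p * y)"
    using ex_digit_word[OF p frac_ge_0 frac_lt_1] by blast
  ultimately have "w \<in> K"
    by (simp add: K_def frac_def)
  moreover have "T ` K \<subseteq> K"
  proof -
    \<comment> \<open>Removing the first digit changes the value by the affine map with
      \<open>a = w 0\<close>.\<close>
    have "T w \<in> K" if "w \<in> K" for w
      using that pLC_gap_affine[OF assms(1), of "word_value p w" e "int (w 0)"]
      by (simp add: K_def T_def word_value_shift[OF p]) (simp add: digit_words_def)
    thus ?thesis
      by blast
  qed
  ultimately obtain M where M: "closed M" "M \<subseteq> K" "M \<noteq> {}" "T ` M \<subseteq> M"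
    and min: "\<And>N. closed N \<Longrightarrow> N \<subseteq> M \<Longrightarrow> N \<noteq> {} \<Longrightarrow> T ` N \<subseteq> N \<Longrightarrow> N = M"
    using minimal_invariant_closed_subset[OF compact closed, of T] by blast
  obtain v where "v \<in> M"
    using M(3) by blast
  hence v: "v \<in> digit_words p" "word_value p v \<in> pLC_gap p e"
    using M(2) by (auto simp: K_def)
  have "compact M"
    using compact_Int_closed[OF compact M(1)] M(2) by (simp add: Int_absorb1)
  hence "uniformly_recurrent v"
    using M(1,4) min \<open>v \<in> M\<close>
    by (intro minimal_subshift_uniformly_recurrent[of M]) (auto simp: T_def image_subset_iff)
  moreover have "is_base_expansion p (word_value p v) v"
    using v(1) summable_sums[OF summable_digits[OF p v(1)]]
    by (simp add: is_base_expansion_def digit_words_def word_value_def)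
  ultimately show ?thesis
    using word_value_bounds[OF p v(1)] pLC_gap_imp_counterexample[OF \<open>0 < e\<close> v(2)] by blast
qed

end
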